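(* Let $(A,\mu)\in\mathcal C$, let $M$ be an $A$-bimodule and let $\mathfrak R:M\to A$ be a relative Rota-Baxter operator of weight zero. Define a left and a right action of $M$ on $A$ by setting $$m\triangleright a:=\mathfrak R(m)a-\mathfrak R(m\cdot a),\quad a\triangleleft m:=a\mathfrak R(m)-\mathfrak R(a\cdot m),$$ for all $a\in A$, $m\in M$. Then $(A,\triangleright,\triangleleft)$ is an $(M,\star)$-bimodule, where $m\star m':=\mathfrak R(m)\cdot m'+m\cdot\mathfrak R(m')$ for all $m,m'\in M$.
   Context: Fix a commutative ring $R$; all modules, tensor products and linear maps are over $R$. An algebra $(A,\mu)$ is an $R$-module $A$ with a linear map (product) $\mu:A\otimes A\to A$; no associativity or unit is assumed. Write $ab=\mu(a\otimes b)$. Fix a collection of multilinear relations $\mathcal R_1=0,\dots,\mathcal R_k=0$ in one binary product: an $n$-linear relation is an $R$-linear combination of parenthesized (non-associative) monomials in $x_1,\dots,x_n$, each variable occurring exactly once in each monomial. $\mathcal C$ is the category of all algebras $(A,\mu)$ in which these relations hold for all substitutions of elements of $A$; $(A,\mu)\in\mathcal C$ means that $(A,\mu)$ satisfies all of them. Bimodule: let $(A,\mu)\in\mathcal C$ and let $M$ be an $R$-module with linear maps $l,r:A\to\mathrm{End}(M)$, written $a\cdot m:=l(a)(m)$ and $m\cdot a:=r(a)(m)$ (left and right actions). $(M,l,r)$, or simply $M$, is an $A$-bimodule if $A\oplus M$ with the product $(a,m)*(a',m'):=(aa',a\cdot m'+m\cdot a')$ belongs to $\mathcal C$. In particular, "$(A,\triangleright,\triangleleft)$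 is an $(M,\star)$-bimodule" means that $(M,\star)\in\mathcal C$ and that $M\oplus A$ with the product $(m,a)\diamond(m',a'):=(m\star m',m\triangleright a'+a\triangleleft m')$ belongs to $\mathcal C$. Relative Rota-Baxter operator of weight zero on the $A$-bimodule $M$: a linear map $\mathfrak R:M\to A$ with $\mathfrak R(m)\mathfrak R(m')=\mathfrak R(\mathfrak R(m)\cdot m'+m\cdot\mathfrak R(m'))$ for all $m,m'\in M$. *)

theory Defs
  imports "HOL-Algebra.Module"
begin

text \<open>
  Modules are HOL-Algebra modules \<open>module R A\<close>. The fields \<open>mult\<close> and \<open>one\<close> of the
  underlying record carry no meaning for a module and are ignored throughout; the product of an
  algebra is a separate function \<open>\<mu>\<close>. A linear map out of a tensor product, such as
  \<open>\<mu> : A \<otimes> A \<rightarrow> A\<close>, and a linear map \<open>A \<rightarrow> End(M)\<close> are both given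
  by the corresponding curried bilinear function.
\<close>

definition linear_maps ::
  "('r, 'x) ring_scheme \<Rightarrow> ('r, 'a, 'y) module_scheme \<Rightarrow> ('r, 'b, 'z) module_scheme \<Rightarrow> ('a \<Rightarrow> 'b) set"
  where "linear_maps R A B =
    {f \<in> hom (add_monoid A) (add_monoid B).
      \<forall>c\<in>carrier R. \<forall>x\<in>carrier A. f (c \<odot>\<^bsub>A\<^esub> x) = c \<odot>\<^bsub>B\<^esub> f x}"

definition bilinear_maps ::
  "('r, 'x) ring_scheme \<Rightarrow> ('r, 'a, 'y) module_scheme \<Rightarrow> ('r, 'b, 'z) module_scheme \<Rightarrow>
    ('r, 'c, 'w) module_scheme \<Rightarrow> ('a \<Rightarrow> 'b \<Rightarrow> 'c) set"
  where "bilinear_maps R A B C =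
    {f. (\<forall>a\<in>carrier A. f a \<in> linear_maps R B C) \<and>
        (\<forall>b\<in>carrier B. (\<lambda>a. f a b) \<in> linear_maps R A C)}"

definition direct_sum ::
  "('r, 'a, 'y) module_scheme \<Rightarrow> ('r, 'b, 'z) module_scheme \<Rightarrow> ('r, 'a \<times> 'b) module"
  where "direct_sum A B =
    \<lparr>carrier = carrier A \<times> carrier B,
     mult = (\<lambda>(a, b) (a', b'). (a \<otimes>\<^bsub>A\<^esub> a', b \<otimes>\<^bsub>B\<^esub> b')),
     one = (\<one>\<^bsub>A\<^esub>, \<one>\<^bsub>B\<^esub>),
     zero = (\<zero>\<^bsub>A\<^esub>, \<zero>\<^bsub>B\<^esub>),
     add = (\<lambda>(a, b) (a', b'). (a \<oplus>\<^bsub>A\<^esub> a', b \<oplus>\<^bsub>B\<^esub> b')),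
     smult = (\<lambda>c (a, b). (c \<odot>\<^bsub>A\<^esub> a, c \<odot>\<^bsub>B\<^esub> b))\<rparr>"

text \<open>Parenthesized non-associative monomials in the variables \<open>x\<^sub>1, x\<^sub>2, \<dots>\<close>.\<close>

datatype monomial = Var nat | Mul monomial monomial

fun variables :: "monomial \<Rightarrow> nat list" where
  "variables (Var i) = [i]"
| "variables (Mul s t) = variables s @ variables t"

fun eval_monomial :: "('a \<Rightarrow> 'a \<Rightarrow> 'a) \<Rightarrow> (nat \<Rightarrow> 'a) \<Rightarrow> monomial \<Rightarrow> 'a" where
  "eval_monomial \<mu> x (Var i) = x i"
| "eval_monomial \<mu> x (Mul s t) = \<mu> (eval_monomial \<mu> x s) (eval_monomial \<mu> x t)"

text \<open>
  The linear combination \<open>c\<^sub>1 t\<^sub>1 + \<dots> + c\<^sub>s t\<^sub>s\<close> is the list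
  \<open>[(c\<^sub>1, t\<^sub>1), \<dots>, (c\<^sub>s, t\<^sub>s)]\<close>.
\<close>

type_synonym 'r relation = "('r \<times> monomial) list"

definition linear_relation :: "('r, 'x) ring_scheme \<Rightarrow> nat \<Rightarrow> 'r relation \<Rightarrow> bool"
  where "linear_relation R n p \<longleftrightarrow>
    (\<forall>(c, t)\<in>set p. c \<in> carrier R \<and> distinct (variables t) \<and> set (variables t) = {1..n})"

definition eval_relation ::
  "('r, 'a, 'y) module_scheme \<Rightarrow> ('a \<Rightarrow> 'a \<Rightarrow> 'a) \<Rightarrow> (nat \<Rightarrow> 'a) \<Rightarrow> 'r relation \<Rightarrow> 'a"
  where "eval_relation A \<mu> x p =
    foldr (\<lambda>(c, t) s. c \<odot>\<^bsub>A\<^esub> eval_monomial \<mu> x t \<oplus>\<^bsub>A\<^esub> s) p \<zero>\<^bsub>A\<^esub>"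

text \<open>
  \<open>in_category R \<R> A \<mu>\<close> is \<open>(A, \<mu>) \<in> \<C>\<close>, for the category given by the relations
  in \<open>\<R>\<close>. A substitution assigns an element of \<open>A\<close> to every variable; an
  \<open>n\<close>-linear relation only sees the values at \<open>1, \<dots>, n\<close>.
\<close>

definition in_category ::
  "('r, 'x) ring_scheme \<Rightarrow> 'r relation list \<Rightarrow> ('r, 'a, 'y) module_scheme \<Rightarrow> ('a \<Rightarrow> 'a \<Rightarrow> 'a) \<Rightarrow> bool"
  where "in_category R \<R> A \<mu> \<longleftrightarrow>
    module R A \<and> \<mu> \<in> bilinear_maps R A A A \<and>
    (\<forall>p\<in>set \<R>. \<forall>x\<in>UNIV \<rightarrow> carrier A. eval_relation A \<mu> x p = \<zero>\<^bsub>A\<^esub>)"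

text \<open>
  Both actions take the acting algebra element first: \<open>l a m\<close> is \<open>a \<cdot> m\<close> and
  \<open>r a m\<close> is \<open>m \<cdot> a\<close>.
\<close>

definition bimodule_product ::
  "('a \<Rightarrow> 'a \<Rightarrow> 'a) \<Rightarrow> ('r, 'm, 'z) module_scheme \<Rightarrow> ('a \<Rightarrow> 'm \<Rightarrow> 'm) \<Rightarrow> ('a \<Rightarrow> 'm \<Rightarrow> 'm) \<Rightarrow>
    'a \<times> 'm \<Rightarrow> 'a \<times> 'm \<Rightarrow> 'a \<times> 'm"
  where "bimodule_product \<mu> M l r = (\<lambda>(a, m) (a', m'). (\<mu> a a', l a m' \<oplus>\<^bsub>M\<^esub> r a' m))"

definition bimodule ::
  "('r, 'x) ring_scheme \<Rightarrow> 'r relation list \<Rightarrow> ('r, 'a, 'y) module_scheme \<Rightarrow> ('a \<Rightarrow> 'a \<Rightarrow> 'a) \<Rightarrow>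
    ('r, 'm, 'z) module_scheme \<Rightarrow> ('a \<Rightarrow> 'm \<Rightarrow> 'm) \<Rightarrow> ('a \<Rightarrow> 'm \<Rightarrow> 'm) \<Rightarrow> bool"
  where "bimodule R \<R> A \<mu> M l r \<longleftrightarrow>
    in_category R \<R> A \<mu> \<and> module R M \<and>
    l \<in> bilinear_maps R A M M \<and> r \<in> bilinear_maps R A M M \<and>
    in_category R \<R> (direct_sum A M) (bimodule_product \<mu> M l r)"

definition relative_rota_baxter ::
  "('r, 'x) ring_scheme \<Rightarrow> ('r, 'a, 'y) module_scheme \<Rightarrow> ('a \<Rightarrow> 'a \<Rightarrow> 'a) \<Rightarrow>
    ('r, 'm, 'z) module_scheme \<Rightarrow> ('a \<Rightarrow> 'm \<Rightarrow> 'm) \<Rightarrow> ('a \<Rightarrow> 'm \<Rightarrow> 'm) \<Rightarrow> ('m \<Rightarrow> 'a) \<Rightarrow> bool"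
  where "relative_rota_baxter R A \<mu> M l r T \<longleftrightarrow>
    T \<in> linear_maps R M A \<and>
    (\<forall>m\<in>carrier M. \<forall>m'\<in>carrier M. \<mu> (T m) (T m') = T (l (T m) m' \<oplus>\<^bsub>M\<^esub> r (T m') m))"

end

theory Submission
  imports Defs "HOL-Algebra.AbelCoset"
begin

text \<open>
  Work in the semidirect product \<open>B = A \<oplus> M\<close>, where \<open>T\<close> is a relative Rota-Baxter operator
  if and only if its graph \<open>{(T m, m)}\<close> is a subalgebra; the graph is then a copy of
  \<open>(M, \<star>)\<close>. As the relations are multilinear, the dual numbers \<open>B \<oplus> B\<epsilon>\<close> again
  satisfy them, so \<open>B\<close> is a bimodule over the graph, and so is the quotient of \<open>B\<close> by the
  graph. Identifying this quotient with \<open>A\<close> through \<open>(a, m) \<mapsto> a - T m\<close> turns the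
  quotient actions into \<open>\<triangleright>\<close> and \<open>\<triangleleft>\<close>.
\<close>

section \<open>Linear and bilinear maps\<close>

lemma linear_mapsI:
  assumes "\<And>x. x \<in> carrier A \<Longrightarrow> f x \<in> carrier B"
    and "\<And>x y. x \<in> carrier A \<Longrightarrow> y \<in> carrier A \<Longrightarrow> f (x \<oplus>\<^bsub>A\<^esub> y) = f x \<oplus>\<^bsub>B\<^esub> f y"
    and "\<And>c x. c \<in> carrier R \<Longrightarrow> x \<in> carrier A \<Longrightarrow> f (c \<odot>\<^bsub>A\<^esub> x) = c \<odot>\<^bsub>B\<^esub> f x"
  shows "f \<in> linear_maps R A B"
  using assms by (auto simp: linear_maps_def hom_def)

lemma linear_mapsD:
  assumes "f \<in> linear_maps R A B"
  shows linear_maps_closed: "x \<in> carrier A \<Longrightarrow> f x \<in> carrier B"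
    and linear_maps_add: "x \<in> carrier A \<Longrightarrow> y \<in> carrier A \<Longrightarrow> f (x \<oplus>\<^bsub>A\<^esub> y) = f x \<oplus>\<^bsub>B\<^esub> f y"
    and linear_maps_smult: "c \<in> carrier R \<Longrightarrow> x \<in> carrier A \<Longrightarrow> f (c \<odot>\<^bsub>A\<^esub> x) = c \<odot>\<^bsub>B\<^esub> f x"
  using assms by (auto simp: linear_maps_def hom_def)

text \<open>Bridge to the group homomorphisms of HOL-Algebra, from which preservation of zero and of
  differences is taken.\<close>

lemma linear_maps_abelian_group_hom:
  assumes "module R A" "module R B" "f \<in> linear_maps R A B"
  shows "abelian_group_hom A B f"
proof -
  interpret A: module R A by fact
  interpret B: module R B by fact
  show ?thesis
    using assms(3)
    by (auto intro!: abelian_group_homI group_hom.intro group_hom_axioms.intro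
        A.abelian_group_axioms B.abelian_group_axioms A.a_group B.a_group simp: linear_maps_def)
qed

lemma linear_maps_zero:
  assumes "module R A" "module R B" "f \<in> linear_maps R A B"
  shows "f \<zero>\<^bsub>A\<^esub> = \<zero>\<^bsub>B\<^esub>"
  using abelian_group_hom.hom_zero[OF linear_maps_abelian_group_hom[OF assms]] .

lemma linear_maps_minus:
  assumes "module R A" "module R B" "f \<in> linear_maps R A B" "x \<in> carrier A" "y \<in> carrier A"
  shows "f (x \<ominus>\<^bsub>A\<^esub> y) = f x \<ominus>\<^bsub>B\<^esub> f y"
proof -
  interpret f: abelian_group_hom A B f
    by (rule linear_maps_abelian_group_hom[OF assms(1-3)])
  show ?thesis
    using assms(4,5) by (simp add: a_minus_def)
qed

lemma linear_maps_finsum: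
  assumes "module R A" "module R B" "f \<in> linear_maps R A B" "finite I" "x \<in> I \<rightarrow> carrier A"
  shows "f (finsum A x I) = (\<Oplus>\<^bsub>B\<^esub>i\<in>I. f (x i))"
proof -
  interpret A: module R A by fact
  interpret B: module R B by fact
  from assms(4,5) show ?thesis
    by induction (auto simp: linear_maps_zero[OF assms(1-3)] linear_mapsD[OF assms(3)] Pi_def)
qed

lemma linear_maps_comp:
  assumes "g \<in> linear_maps R B C" "f \<in> linear_maps R A B"
  shows "(\<lambda>x. g (f x)) \<in> linear_maps R A C"
  by (rule linear_mapsI) (simp_all add: linear_mapsD[OF assms(1)] linear_mapsD[OF assms(2)])

lemma linear_maps_plus:
  assumes "module R B" "f \<in> linear_maps R A B" "g \<in> linear_maps R A B"
  shows "(\<lambda>x. f x \<oplus>\<^bsub>B\<^esub> g x) \<in> linear_maps R A B"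
proof -
  interpret B: module R B by fact
  show ?thesis
    by (rule linear_mapsI)
      (simp_all add: linear_mapsD[OF assms(2)] linear_mapsD[OF assms(3)] B.a_ac B.smult_r_distr)
qed

lemma linear_maps_diff:
  assumes "module R B" "f \<in> linear_maps R A B" "g \<in> linear_maps R A B"
  shows "(\<lambda>x. f x \<ominus>\<^bsub>B\<^esub> g x) \<in> linear_maps R A B"
proof -
  interpret B: module R B by fact
  show ?thesis
    by (rule linear_mapsI)
      (simp_all add: linear_mapsD[OF assms(2)] linear_mapsD[OF assms(3)] B.a_ac B.smult_r_distr
        a_minus_def B.minus_add B.smult_r_minus)
qed

lemma bilinear_mapsI:
  assumes "\<And>a. a \<in> carrier A \<Longrightarrow> f a \<in> linear_maps R B C"
    and "\<And>b. b \<in> carrier B \<Longrightarrow> (\<lambda>a. f a b) \<in> linear_maps R A C"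
  shows "f \<in> bilinear_maps R A B C"
  using assms by (simp add: bilinear_maps_def)

lemma bilinear_mapsD:
  assumes "f \<in> bilinear_maps R A B C"
  shows bilinear_maps_right: "a \<in> carrier A \<Longrightarrow> f a \<in> linear_maps R B C"
    and bilinear_maps_left: "b \<in> carrier B \<Longrightarrow> (\<lambda>a. f a b) \<in> linear_maps R A C"
  using assms by (simp_all add: bilinear_maps_def)

lemma bilinear_maps_closed:
  "f \<in> bilinear_maps R A B C \<Longrightarrow> a \<in> carrier A \<Longrightarrow> b \<in> carrier B \<Longrightarrow> f a b \<in> carrier C"
  by (rule linear_maps_closed[OF bilinear_maps_right])

lemma bilinear_maps_flip:
  assumes "f \<in> bilinear_maps R A B C"
  shows "(\<lambda>b a. f a b) \<in> bilinear_maps R B A C"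
  by (rule bilinear_mapsI) (simp_all add: bilinear_mapsD[OF assms])

lemma bilinear_maps_comp:
  assumes "f \<in> bilinear_maps R A B C" "g \<in> linear_maps R A' A" "h \<in> linear_maps R B' B"
  shows "(\<lambda>a b. f (g a) (h b)) \<in> bilinear_maps R A' B' C"
  by (rule bilinear_mapsI)
    (simp_all add: linear_maps_comp[OF bilinear_maps_right[OF assms(1)] assms(3)]
      linear_maps_comp[OF bilinear_maps_left[OF assms(1)] assms(2)]
      linear_maps_closed[OF assms(2)] linear_maps_closed[OF assms(3)])

lemma bilinear_maps_post_comp:
  assumes "h \<in> linear_maps R C D" "f \<in> bilinear_maps R A B C"
  shows "(\<lambda>a b. h (f a b)) \<in> bilinear_maps R A B D"
  by (rule bilinear_mapsI) (simp_all add: linear_maps_comp[OF assms(1)] bilinear_mapsD[OF assms(2)])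

lemma bilinear_maps_plus:
  assumes "module R C" "f \<in> bilinear_maps R A B C" "g \<in> bilinear_maps R A B C"
  shows "(\<lambda>a b. f a b \<oplus>\<^bsub>C\<^esub> g a b) \<in> bilinear_maps R A B C"
  by (rule bilinear_mapsI)
    (simp_all add: linear_maps_plus[OF assms(1)] bilinear_mapsD[OF assms(2)] bilinear_mapsD[OF assms(3)])

lemma bilinear_maps_diff:
  assumes "module R C" "f \<in> bilinear_maps R A B C" "g \<in> bilinear_maps R A B C"
  shows "(\<lambda>a b. f a b \<ominus>\<^bsub>C\<^esub> g a b) \<in> bilinear_maps R A B C"
  by (rule bilinear_mapsI)
    (simp_all add: linear_maps_diff[OF assms(1)] bilinear_mapsD[OF assms(2)] bilinear_mapsD[OF assms(3)])

section \<open>Direct sums\<close>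

lemma direct_sum_simps [simp]:
  "carrier (direct_sum A B) = carrier A \<times> carrier B"
  "\<zero>\<^bsub>direct_sum A B\<^esub> = (\<zero>\<^bsub>A\<^esub>, \<zero>\<^bsub>B\<^esub>)"
  "x \<oplus>\<^bsub>direct_sum A B\<^esub> y = (fst x \<oplus>\<^bsub>A\<^esub> fst y, snd x \<oplus>\<^bsub>B\<^esub> snd y)"
  "c \<odot>\<^bsub>direct_sum A B\<^esub> x = (c \<odot>\<^bsub>A\<^esub> fst x, c \<odot>\<^bsub>B\<^esub> snd x)"
  by (simp_all add: direct_sum_def case_prod_beta)

lemma module_direct_sum:
  assumes "module R A" "module R B"
  shows "module R (direct_sum A B)"
proof -
  interpret A: module R A by fact
  interpret B: module R B by fact
  have "abelian_group (direct_sum A B)"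
  proof (rule abelian_groupI)
    fix x assume "x \<in> carrier (direct_sum A B)"
    then show "\<exists>y\<in>carrier (direct_sum A B). y \<oplus>\<^bsub>direct_sum A B\<^esub> x = \<zero>\<^bsub>direct_sum A B\<^esub>"
      by (intro bexI[of _ "(\<ominus>\<^bsub>A\<^esub> fst x, \<ominus>\<^bsub>B\<^esub> snd x)"]) (auto simp: A.l_neg B.l_neg)
  qed (auto simp: A.a_ac B.a_ac)
  then show ?thesis
    by (rule moduleI[OF A.R.cring_axioms])
      (auto simp: A.smult_l_distr A.smult_r_distr A.smult_assoc1
        B.smult_l_distr B.smult_r_distr B.smult_assoc1)
qed

lemma fst_linear: "fst \<in> linear_maps R (direct_sum A B) A"
  by (rule linear_mapsI) auto

lemma snd_linear: "snd \<in> linear_maps R (direct_sum A B) B"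
  by (rule linear_mapsI) auto

lemma Pair_linear:
  assumes "f \<in> linear_maps R C A" "g \<in> linear_maps R C B"
  shows "(\<lambda>x. (f x, g x)) \<in> linear_maps R C (direct_sum A B)"
  by (rule linear_mapsI) (simp_all add: linear_mapsD[OF assms(1)] linear_mapsD[OF assms(2)])

text \<open>Written with projections, the product is a composite of bilinear maps with
  \<open>fst\<close> and \<open>snd\<close>, so its bilinearity follows from the closure lemmas
  without splitting pairs.\<close>

lemma bimodule_product_eq:
  "bimodule_product \<mu> M l r =
    (\<lambda>x y. (\<mu> (fst x) (fst y), l (fst x) (snd y) \<oplus>\<^bsub>M\<^esub> r (fst y) (snd x)))"
  by (simp add: bimodule_product_def case_prod_beta fun_eq_iff)

lemma bimodule_product_bilinear:
  assumes "module R M" "\<mu> \<in> bilinear_maps R A A A"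
    and "l \<in> bilinear_maps R A M M" "r \<in> bilinear_maps R A M M"
  shows "bimodule_product \<mu> M l r \<in>
    bilinear_maps R (direct_sum A M) (direct_sum A M) (direct_sum A M)"
proof -
  let ?D = "direct_sum A M"
  have 1: "(\<lambda>x y. \<mu> (fst x) (fst y)) \<in> bilinear_maps R ?D ?D A"
    by (rule bilinear_maps_comp[OF assms(2) fst_linear fst_linear])
  have 2: "(\<lambda>x y. l (fst x) (snd y) \<oplus>\<^bsub>M\<^esub> r (fst y) (snd x)) \<in> bilinear_maps R ?D ?D M"
    \<comment> \<open>The right action takes its algebra element first, and that element comes from
      \<open>y\<close>; hence the flip in the second summand.\<close>
    by (rule bilinear_maps_plus[OF assms(1) bilinear_maps_comp[OF assms(3) fst_linear snd_linear]
          bilinear_maps_flip[OF bilinear_maps_comp[OF assms(4) fst_linear snd_linear]]])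
  show ?thesis
    unfolding bimodule_product_eq
    by (rule bilinear_mapsI; rule Pair_linear; simp only: bilinear_mapsD[OF 1] bilinear_mapsD[OF 2])
qed

section \<open>Relations\<close>

lemma eval_relation_simps [simp]:
  "eval_relation A \<mu> x [] = \<zero>\<^bsub>A\<^esub>"
  "eval_relation A \<mu> x ((c, t) # p) = c \<odot>\<^bsub>A\<^esub> eval_monomial \<mu> x t \<oplus>\<^bsub>A\<^esub> eval_relation A \<mu> x p"
  by (simp_all add: eval_relation_def)

lemma linear_relation_simps [simp]:
  "linear_relation R n []"
  "linear_relation R n ((c, t) # p) \<longleftrightarrow>
    c \<in> carrier R \<and> distinct (variables t) \<and> set (variables t) = {1..n} \<and> linear_relation R n p"
  by (auto simp: linear_relation_def)

lemma eval_monomial_closed: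
  assumes "\<And>a b. a \<in> S \<Longrightarrow> b \<in> S \<Longrightarrow> \<mu> a b \<in> S" "\<And>i. x i \<in> S"
  shows "eval_monomial \<mu> x t \<in> S"
  using assms by (induction t) auto

lemma eval_relation_closed:
  assumes "module R A" "\<And>a b. a \<in> carrier A \<Longrightarrow> b \<in> carrier A \<Longrightarrow> \<mu> a b \<in> carrier A"
    and "\<And>i. x i \<in> carrier A" "linear_relation R n p"
  shows "eval_relation A \<mu> x p \<in> carrier A"
proof -
  interpret A: module R A by fact
  from assms(4) show ?thesis
    by (induction p)
      (auto intro!: A.M.a_closed A.smult_closed eval_monomial_closed[where S = "carrier A"] assms(2,3))
qed

lemma eval_monomial_cong:
  assumes "\<And>i. i \<in> set (variables t) \<Longrightarrow> x i = y i"
  shows "eval_monomial \<mu> x t = eval_monomial \<mu> y t"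
  using assms by (induction t) auto

lemma eval_monomial_hom:
  assumes "\<And>a b. a \<in> S \<Longrightarrow> b \<in> S \<Longrightarrow> \<mu> a b \<in> S" "\<And>i. x i \<in> S"
    and "\<And>a b. a \<in> S \<Longrightarrow> b \<in> S \<Longrightarrow> f (\<mu> a b) = \<nu> (f a) (f b)"
  shows "f (eval_monomial \<mu> x t) = eval_monomial \<nu> (\<lambda>i. f (x i)) t"
  by (induction t) (auto simp: assms(3) eval_monomial_closed[where S = S] assms(1,2))

text \<open>Monomials never leave the multiplicatively closed set \<open>S\<close>, so
  multiplicativity of \<open>f\<close> on \<open>S\<close> suffices for them; the linear combination
  is then formed in all of \<open>A\<close>, where \<open>f\<close> is linear.\<close>

lemma eval_relation_hom:
  assumes "module R A" "module R B" "f \<in> linear_maps R A B" "S \<subseteq> carrier A"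
    and bil: "\<mu> \<in> bilinear_maps R A A A"
    and closed: "\<And>a b. a \<in> S \<Longrightarrow> b \<in> S \<Longrightarrow> \<mu> a b \<in> S"
    and hom: "\<And>a b. a \<in> S \<Longrightarrow> b \<in> S \<Longrightarrow> f (\<mu> a b) = \<nu> (f a) (f b)"
    and x: "\<And>i. x i \<in> S" and p: "linear_relation R n p"
  shows "f (eval_relation A \<mu> x p) = eval_relation B \<nu> (\<lambda>i. f (x i)) p"
  using p
proof (induction p)
  case Nil
  then show ?case
    by (simp add: linear_maps_zero[OF assms(1-3)])
next
  case (Cons q p)
  obtain c t where q: "q = (c, t)" by force
  interpret A: module R A by fact
  have "eval_monomial \<mu> x t \<in> carrier A"
    using eval_monomial_closed[where S = S] closed x \<open>S \<subseteq> carrier A\<close> by blast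
  moreover have "eval_relation A \<mu> x p \<in> carrier A"
    using Cons.prems x \<open>S \<subseteq> carrier A\<close>
    by (auto simp: q intro!: eval_relation_closed[OF assms(1)] bilinear_maps_closed[OF bil])
  ultimately show ?case
    using Cons
    using eval_monomial_hom[where S = S and \<mu> = \<mu> and \<nu> = \<nu> and f = f and x = x and t = t, OF closed x hom]
    by (simp add: q linear_mapsD[OF assms(3)])
qed

text \<open>Relations pass to a homomorphic image of a subalgebra: lift the substituted elements to
  \<open>S\<close>, evaluate in \<open>A\<close>, where the relation holds, and apply
  \<open>f\<close>. This handles subalgebras and quotients at once, without constructing either as a
  module of its own.\<close>

lemma in_category_image:
  assumes rels: "\<forall>p\<in>set \<R>. \<exists>n. linear_relation R n p"
    and A: "in_category R \<R> A \<mu>" and B: "module R B" "\<nu> \<in> bilinear_maps R B B B"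
    and f: "f \<in> linear_maps R A B" and S: "S \<subseteq> carrier A" "carrier B \<subseteq> f ` S"
    and closed: "\<And>a b. a \<in> S \<Longrightarrow> b \<in> S \<Longrightarrow> \<mu> a b \<in> S"
    and hom: "\<And>a b. a \<in> S \<Longrightarrow> b \<in> S \<Longrightarrow> f (\<mu> a b) = \<nu> (f a) (f b)"
  shows "in_category R \<R> B \<nu>"
  unfolding in_category_def
proof (intro conjI B ballI)
  fix p and x :: "nat \<Rightarrow> _" assume p: "p \<in> set \<R>" and x: "x \<in> UNIV \<rightarrow> carrier B"
  have mA: "module R A" "\<mu> \<in> bilinear_maps R A A A"
    using A by (auto simp: in_category_def)
  have "\<exists>y. y \<in> S \<and> f y = x i" for i
  proof -
    have "x i \<in> f ` S"
      using x S(2) by (auto simp: Pi_def)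
    then show ?thesis by auto
  qed
  then obtain y where y: "\<And>i. y i \<in> S" "\<And>i. f (y i) = x i"
    by metis
  obtain n where n: "linear_relation R n p"
    using rels p by blast
  have "eval_relation B \<nu> x p = f (eval_relation A \<mu> y p)"
    using eval_relation_hom[where \<nu> = \<nu> and x = y, OF mA(1) B(1) f S(1) mA(2) closed hom y(1) n]
    by (simp add: y(2))
  also have "eval_relation A \<mu> y p = \<zero>\<^bsub>A\<^esub>"
    using A p subsetD[OF S(1) y(1)] by (auto simp: in_category_def)
  also have "f \<zero>\<^bsub>A\<^esub> = \<zero>\<^bsub>B\<^esub>"
    by (rule linear_maps_zero[OF mA(1) B(1) f])
  finally show "eval_relation B \<nu> x p = \<zero>\<^bsub>B\<^esub>" .
qed

section \<open>Dual numbers\<close>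

text \<open>The pair \<open>(a, b)\<close> stands for a + b \<epsilon> with \<epsilon> squared equal
  to zero: the algebra acts on a second copy of itself by multiplication.\<close>

abbreviation dual_product ::
  "('r, 'a, 'y) module_scheme \<Rightarrow> ('a \<Rightarrow> 'a \<Rightarrow> 'a) \<Rightarrow> 'a \<times> 'a \<Rightarrow> 'a \<times> 'a \<Rightarrow> 'a \<times> 'a"
  where "dual_product A \<mu> \<equiv> bimodule_product \<mu> A \<mu> (\<lambda>a b. \<mu> b a)"

text \<open>The substitution behind the \<open>i\<close>-th term of the Leibniz rule.\<close>

definition eps_at :: "(nat \<Rightarrow> 'a \<times> 'a) \<Rightarrow> nat \<Rightarrow> nat \<Rightarrow> 'a"
  where "eps_at x i j = (if j = i then snd (x j) else fst (x j))"

lemma snd_dual_product: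
  "snd (dual_product A \<mu> x y) = \<mu> (fst x) (snd y) \<oplus>\<^bsub>A\<^esub> \<mu> (snd x) (fst y)"
  by (simp add: bimodule_product_eq)

lemma fst_eval_monomial_dual:
  "fst (eval_monomial (dual_product A \<mu>) x t) = eval_monomial \<mu> (fst \<circ> x) t"
  by (induction t) (simp_all add: bimodule_product_eq)

text \<open>Leibniz rule: since \<epsilon> squares to zero, each term of the \<epsilon>-part takes
  \<epsilon> from exactly one leaf. Distinctness lets a variable name that leaf;
  \<open>eps_at\<close> would alter all occurrences of a repeated variable at once.\<close>

lemma snd_eval_monomial_dual:
  assumes A: "module R A" and \<mu>: "\<mu> \<in> bilinear_maps R A A A"
    and x: "\<And>i. x i \<in> carrier A \<times> carrier A" and t: "distinct (variables t)"
  shows "snd (eval_monomial (dual_product A \<mu>) x t) =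
    (\<Oplus>\<^bsub>A\<^esub>i\<in>set (variables t). eval_monomial \<mu> (eps_at x i) t)"
  using t
proof (induction t)
  interpret A: module R A by fact
  {
    case (Var j)
    show ?case using x[of j] by (simp add: mem_Times_iff eps_at_def)
  next
    case (Mul s t)
    let ?e = "eval_monomial \<mu>"
    have closed: "?e (eps_at x i) u \<in> carrier A" "?e (fst \<circ> x) u \<in> carrier A" for i u
      using x by (auto simp: eps_at_def mem_Times_iff intro!: eval_monomial_closed bilinear_maps_closed[OF \<mu>])
    have disj: "set (variables s) \<inter> set (variables t) = {}"
      using Mul.prems by simp
    \<comment> \<open>If \<epsilon> is taken from a leaf of one factor, the other factor contributes
      its plain value, as the variable does not occur there.\<close>
    have s: "?e (eps_at x i) s = ?e (fst \<circ> x) s" if "i \<in> set (variables t)" for i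
      using that disj by (intro eval_monomial_cong) (auto simp: eps_at_def)
    have t: "?e (eps_at x i) t = ?e (fst \<circ> x) t" if "i \<in> set (variables s)" for i
      using that disj by (intro eval_monomial_cong) (auto simp: eps_at_def)
    have "\<mu> (?e (fst \<circ> x) s) (\<Oplus>\<^bsub>A\<^esub>i\<in>set (variables t). ?e (eps_at x i) t) =
        (\<Oplus>\<^bsub>A\<^esub>i\<in>set (variables t). \<mu> (?e (fst \<circ> x) s) (?e (eps_at x i) t))"
      by (intro linear_maps_finsum[OF A A bilinear_maps_right[OF \<mu>]]) (auto simp: closed)
    also have "\<dots> = (\<Oplus>\<^bsub>A\<^esub>i\<in>set (variables t). ?e (eps_at x i) (Mul s t))"
      by (intro A.finsum_cong') (auto simp: s closed bilinear_maps_closed[OF \<mu>])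
    finally have right: "\<mu> (?e (fst \<circ> x) s) (\<Oplus>\<^bsub>A\<^esub>i\<in>set (variables t). ?e (eps_at x i) t) =
        (\<Oplus>\<^bsub>A\<^esub>i\<in>set (variables t). ?e (eps_at x i) (Mul s t))" .
    have "\<mu> (\<Oplus>\<^bsub>A\<^esub>i\<in>set (variables s). ?e (eps_at x i) s) (?e (fst \<circ> x) t) =
        (\<Oplus>\<^bsub>A\<^esub>i\<in>set (variables s). \<mu> (?e (eps_at x i) s) (?e (fst \<circ> x) t))"
      by (intro linear_maps_finsum[OF A A bilinear_maps_left[OF \<mu>]]) (auto simp: closed)
    also have "\<dots> = (\<Oplus>\<^bsub>A\<^esub>i\<in>set (variables s). ?e (eps_at x i) (Mul s t))"
      by (intro A.finsum_cong') (auto simp: t closed bilinear_maps_closed[OF \<mu>])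
    finally have left: "\<mu> (\<Oplus>\<^bsub>A\<^esub>i\<in>set (variables s). ?e (eps_at x i) s) (?e (fst \<circ> x) t) =
        (\<Oplus>\<^bsub>A\<^esub>i\<in>set (variables s). ?e (eps_at x i) (Mul s t))" .
    have "snd (eval_monomial (dual_product A \<mu>) x (Mul s t)) =
        (\<Oplus>\<^bsub>A\<^esub>i\<in>set (variables t). ?e (eps_at x i) (Mul s t)) \<oplus>\<^bsub>A\<^esub>
        (\<Oplus>\<^bsub>A\<^esub>i\<in>set (variables s). ?e (eps_at x i) (Mul s t))"
      using Mul unfolding right[symmetric] left[symmetric]
      by (simp add: snd_dual_product fst_eval_monomial_dual)
    \<comment> \<open>The two factors share no variable, so the sums merge without double
      counting.\<close>
    also have "\<dots> = (\<Oplus>\<^bsub>A\<^esub>i\<in>set (variables t) \<union> set (variables s). ?e (eps_at x i) (Mul s t))"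
      using disj
      by (intro A.finsum_Un_disjoint[symmetric])
        (auto simp: closed bilinear_maps_closed[OF \<mu>])
    finally show ?case
      by (simp add: Un_commute)
  }
qed

text \<open>All monomials of the relation have the same variables, so their Leibniz sums share the
  index set \<open>{1..n}\<close> and can be exchanged with the linear combination.\<close>

lemma snd_eval_relation_dual:
  assumes A: "module R A" and \<mu>: "\<mu> \<in> bilinear_maps R A A A"
    and x: "\<And>i. x i \<in> carrier A \<times> carrier A" and p: "linear_relation R n p"
  shows "snd (eval_relation (direct_sum A A) (dual_product A \<mu>) x p) =
    (\<Oplus>\<^bsub>A\<^esub>i\<in>{1..n}. eval_relation A \<mu> (eps_at x i) p)"
  using p
proof (induction p)
  interpret A: module R A by fact
  {
    case Nil
    then show ?case by simp
  next
    case (Cons q p)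
    obtain c t where q: "q = (c, t)" by force
    have y: "eps_at x i j \<in> carrier A" for i j
      using x by (auto simp: eps_at_def mem_Times_iff)
    have 1: "eval_monomial \<mu> (eps_at x i) t \<in> carrier A" for i
      by (intro eval_monomial_closed y bilinear_maps_closed[OF \<mu>])
    have 2: "eval_relation A \<mu> (eps_at x i) p \<in> carrier A" for i
      using Cons.prems
      by (auto simp: q y intro!: eval_relation_closed[OF A] bilinear_maps_closed[OF \<mu>])
    have "snd (eval_relation (direct_sum A A) (dual_product A \<mu>) x (q # p)) =
        c \<odot>\<^bsub>A\<^esub> (\<Oplus>\<^bsub>A\<^esub>i\<in>{1..n}. eval_monomial \<mu> (eps_at x i) t) \<oplus>\<^bsub>A\<^esub>
        (\<Oplus>\<^bsub>A\<^esub>i\<in>{1..n}. eval_relation A \<mu> (eps_at x i) p)"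
      using Cons snd_eval_monomial_dual[OF A \<mu> x, of t] by (simp add: q)
    also have "\<dots> = (\<Oplus>\<^bsub>A\<^esub>i\<in>{1..n}. eval_relation A \<mu> (eps_at x i) (q # p))"
      using Cons.prems 1 2 by (simp add: q A.finsum_smult_ldistr)
    finally show ?case .
  }
qed

text \<open>
  This is where multilinearity enters: the \<open>\<epsilon>\<close>-part of a relation is the sum of its values
  with one argument replaced by the \<open>\<epsilon>\<close>-part of that argument.
\<close>

lemma in_category_dual:
  assumes rels: "\<forall>p\<in>set \<R>. \<exists>n. linear_relation R n p" and A: "in_category R \<R> A \<mu>"
  shows "in_category R \<R> (direct_sum A A) (dual_product A \<mu>)"
proof -
  have mA: "module R A" and \<mu>: "\<mu> \<in> bilinear_maps R A A A"
    and zero: "\<And>p x. p \<in> set \<R> \<Longrightarrow> (\<And>i. x i \<in> carrier A) \<Longrightarrow> eval_relation A \<mu> x p = \<zero>\<^bsub>A\<^esub>"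
    using A by (auto simp: in_category_def)
  interpret A: module R A by fact
  have D: "module R (direct_sum A A)"
    by (intro module_direct_sum mA)
  have bil: "dual_product A \<mu> \<in> bilinear_maps R (direct_sum A A) (direct_sum A A) (direct_sum A A)"
    by (intro bimodule_product_bilinear mA \<mu> bilinear_maps_flip[OF \<mu>])
  have "eval_relation (direct_sum A A) (dual_product A \<mu>) x p = (\<zero>\<^bsub>A\<^esub>, \<zero>\<^bsub>A\<^esub>)"
    if p: "p \<in> set \<R>" and x: "\<And>i. x i \<in> carrier A \<times> carrier A" for p x
  proof (rule prod_eqI)
    obtain n where n: "linear_relation R n p"
      using rels p by blast
    have fx: "fst (x i) \<in> carrier A" "snd (x i) \<in> carrier A" for i
      using x[of i] by (auto simp: mem_Times_iff)
    \<comment> \<open>Setting \<epsilon> to zero is an algebra homomorphism onto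
      \<open>A\<close>.\<close>
    have "fst (eval_relation (direct_sum A A) (dual_product A \<mu>) x p) =
        eval_relation A \<mu> (\<lambda>i. fst (x i)) p"
      using x
      by (intro eval_relation_hom[OF D mA fst_linear order.refl bil _ _ _ n])
        (auto simp: bimodule_product_eq bilinear_maps_closed[OF \<mu>])
    then show "fst (eval_relation (direct_sum A A) (dual_product A \<mu>) x p) = fst (\<zero>\<^bsub>A\<^esub>, \<zero>\<^bsub>A\<^esub>)"
      using zero[OF p] fx by simp
    show "snd (eval_relation (direct_sum A A) (dual_product A \<mu>) x p) = snd (\<zero>\<^bsub>A\<^esub>, \<zero>\<^bsub>A\<^esub>)"
      using zero[OF p] fx by (simp add: snd_eval_relation_dual[OF mA \<mu> x n] eps_at_def)
  qed
  then show ?thesis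
    using D bil by (auto simp: in_category_def Pi_iff)
qed

section \<open>The graph of a relative Rota-Baxter operator\<close>

theorem proposition5p7:
  fixes R :: "('r, 'x) ring_scheme"
    and \<R> :: "'r relation list"
    and A :: "('r, 'a, 'y) module_scheme"
    and \<mu> :: "'a \<Rightarrow> 'a \<Rightarrow> 'a"
    and M :: "('r, 'm, 'z) module_scheme"
    and l r :: "'a \<Rightarrow> 'm \<Rightarrow> 'm"
    and T :: "'m \<Rightarrow> 'a"
  assumes "cring R"
    and "\<forall>p\<in>set \<R>. \<exists>n. linear_relation R n p"
    and "in_category R \<R> A \<mu>"
    and "bimodule R \<R> A \<mu> M l r"
    and "relative_rota_baxter R A \<mu> M l r T"
  shows "bimodule R \<R>
           M (\<lambda>m m'. l (T m) m' \<oplus>\<^bsub>M\<^esub> r (T m') m)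
           A (\<lambda>m a. \<mu> (T m) a \<ominus>\<^bsub>A\<^esub> T (r a m))
             (\<lambda>m a. \<mu> a (T m) \<ominus>\<^bsub>A\<^esub> T (l a m))"
proof -
  let ?B = "direct_sum A M" and ?\<beta> = "bimodule_product \<mu> M l r"
  let ?star = "\<lambda>m m'. l (T m) m' \<oplus>\<^bsub>M\<^esub> r (T m') m"
  let ?L = "\<lambda>m a. \<mu> (T m) a \<ominus>\<^bsub>A\<^esub> T (r a m)"
  let ?R = "\<lambda>m a. \<mu> a (T m) \<ominus>\<^bsub>A\<^esub> T (l a m)"
  have A: "module R A" and M: "module R M" and \<mu>: "\<mu> \<in> bilinear_maps R A A A"
    and l: "l \<in> bilinear_maps R A M M" and r: "r \<in> bilinear_maps R A M M"
    and B: "in_category R \<R> ?B ?\<beta>"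
    using assms(3,4) by (auto simp: in_category_def bimodule_def)
  have T: "T \<in> linear_maps R M A"
    and RB: "\<And>m m'. m \<in> carrier M \<Longrightarrow> m' \<in> carrier M \<Longrightarrow> \<mu> (T m) (T m') = T (?star m m')"
    using assms(5) by (auto simp: relative_rota_baxter_def)
  interpret A: module R A by fact
  interpret M: module R M by fact
  \<comment> \<open>Allows \<open>bilinear_maps_comp\<close> to insert \<open>T\<close> in one
    argument only.\<close>
  have id: "(\<lambda>x. x) \<in> linear_maps R N N" for N :: "('r, 'n, 'w) module_scheme"
    by (rule linear_mapsI) simp_all
  note T_simps = linear_mapsD[OF T] linear_maps_minus[OF M A T]
  note closed = bilinear_maps_closed[OF \<mu>] bilinear_maps_closed[OF l] bilinear_maps_closed[OF r]
    linear_maps_closed[OF T]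

  have star: "?star \<in> bilinear_maps R M M M"
    by (intro bilinear_maps_plus M bilinear_maps_comp[OF l T id]
        bilinear_maps_flip[OF bilinear_maps_comp[OF r T id]])
  have L: "?L \<in> bilinear_maps R M A A"
    by (intro bilinear_maps_diff A bilinear_maps_comp[OF \<mu> T id]
        bilinear_maps_post_comp[OF T] bilinear_maps_flip[OF r])
  have R: "?R \<in> bilinear_maps R M A A"
    by (intro bilinear_maps_diff A bilinear_maps_flip[OF bilinear_maps_comp[OF \<mu> id T]]
        bilinear_maps_post_comp[OF T] bilinear_maps_flip[OF l])
  define G where "G = (\<lambda>m. (T m, m)) ` carrier M"
  have G: "G \<subseteq> carrier ?B"
    by (auto simp: G_def closed)
  \<comment> \<open>The product of the graph points over \<open>m\<close> and \<open>m'\<close> has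
    second component \<open>?star m m'\<close>; the Rota-Baxter identity says that its first
    component is \<open>T\<close> of that.\<close>
  have G_closed: "?\<beta> a b \<in> G" if "a \<in> G" "b \<in> G" for a b
    using that by (auto simp: G_def bimodule_product_eq RB closed)

  \<comment> \<open>The projection \<open>snd\<close> carries the product of the graph to
    \<open>?star\<close>.\<close>
  have star_cat: "in_category R \<R> M ?star"
  proof (rule in_category_image[OF assms(2) B M star snd_linear G _ G_closed])
    show "carrier M \<subseteq> snd ` G"
      by (force simp: G_def)
    show "snd (?\<beta> a b) = ?star (snd a) (snd b)" if "a \<in> G" "b \<in> G" for a b
      using that by (auto simp: G_def bimodule_product_eq)
  qed

  \<comment> \<open>For g + b \<epsilon> with g in the graph, the first entry recovers the point of
    \<open>M\<close> below g, and the second is the class of b modulo the graph: the map from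
    \<open>(a, n)\<close> to a - T n has kernel \<open>G\<close>.\<close>
  define \<pi> where "\<pi> x = (snd (fst x), fst (snd x) \<ominus>\<^bsub>A\<^esub> T (snd (snd x)))"
    for x :: "('a \<times> 'm) \<times> ('a \<times> 'm)"
  have cancel_right: "(x \<oplus>\<^bsub>A\<^esub> y) \<ominus>\<^bsub>A\<^esub> y = x" if "x \<in> carrier A" "y \<in> carrier A" for x y
    using that by (simp add: a_minus_def A.a_assoc A.r_neg)
  have cancel_left: "(x \<oplus>\<^bsub>A\<^esub> y) \<ominus>\<^bsub>A\<^esub> x = y" if "x \<in> carrier A" "y \<in> carrier A" for x y
    using that cancel_right[of y x] by (simp add: A.a_comm)
  \<comment> \<open>The Rota-Baxter identity cancels one of the two terms of \<open>?star\<close>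
    under \<open>T\<close>. This is compatibility with the class -T n of \<open>(0, n)\<close>:
    multiplying \<open>(0, n)\<close> by \<open>(T m, m)\<close> on the left gives
    \<open>(0, l (T m) n)\<close>, on the right \<open>(0, r (T m) n)\<close>.\<close>
  have L_T: "?L m (T n) = T (l (T m) n)" and R_T: "?R m (T n) = T (r (T m) n)"
    if "m \<in> carrier M" "n \<in> carrier M" for m n
    using that by (simp_all add: RB T_simps closed cancel_left cancel_right)
  have "in_category R \<R> (direct_sum M A) (bimodule_product ?star A ?L ?R)"
  \<comment> \<open>The subalgebra of the dual numbers over \<open>?B\<close> is
    \<open>G \<times> carrier ?B\<close>: plain part in the graph, arbitrary
    \<epsilon>-part.\<close>
  proof (rule in_category_image[OF assms(2) in_category_dual[OF assms(2) B]])
    show "module R (direct_sum M A)"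
      by (intro module_direct_sum A M)
    show "bimodule_product ?star A ?L ?R \<in>
        bilinear_maps R (direct_sum M A) (direct_sum M A) (direct_sum M A)"
      by (intro bimodule_product_bilinear A star L R)
    show "\<pi> \<in> linear_maps R (direct_sum ?B ?B) (direct_sum M A)"
      unfolding \<pi>_def
      by (intro Pair_linear linear_maps_diff A linear_maps_comp[OF snd_linear fst_linear]
          linear_maps_comp[OF fst_linear snd_linear] linear_maps_comp[OF T]
          linear_maps_comp[OF snd_linear snd_linear])
    show "G \<times> carrier ?B \<subseteq> carrier (direct_sum ?B ?B)"
      using G by auto
    show "carrier (direct_sum M A) \<subseteq> \<pi> ` (G \<times> carrier ?B)"
    proof
      fix z assume z: "z \<in> carrier (direct_sum M A)"
      \<comment> \<open>The class corresponding to an element a of \<open>A\<close> is represented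
        by \<open>(a, 0)\<close>, because T 0 = 0.\<close>
      then have "z = \<pi> ((T (fst z), fst z), (snd z, \<zero>\<^bsub>M\<^esub>))"
        by (auto simp: \<pi>_def linear_maps_zero[OF M A T] a_minus_def)
      with z show "z \<in> \<pi> ` (G \<times> carrier ?B)"
        by (force simp: G_def)
    qed
    fix x y assume x: "x \<in> G \<times> carrier ?B" and y: "y \<in> G \<times> carrier ?B"
    from x obtain m a n where x_eq: "x = ((T m, m), (a, n))"
      and mem: "m \<in> carrier M" "a \<in> carrier A" "n \<in> carrier M"
      by (auto simp: G_def)
    from y obtain m' a' n' where y_eq: "y = ((T m', m'), (a', n'))"
      and mem': "m' \<in> carrier M" "a' \<in> carrier A" "n' \<in> carrier M"
      by (auto simp: G_def)
    show "dual_product ?B ?\<beta> x y \<in> G \<times> carrier ?B"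
      using G_closed[of "(T m, m)" "(T m', m')"] mem mem'
      by (auto simp: x_eq y_eq bimodule_product_eq G_def closed)
    \<comment> \<open>Comparison of second components: \<open>m\<close> acts on the class of
      \<open>(a', n')\<close> from the left and \<open>m'\<close> on the class of
      \<open>(a, n)\<close> from the right.\<close>
    have "?L m (a' \<ominus>\<^bsub>A\<^esub> T n') \<oplus>\<^bsub>A\<^esub> ?R m' (a \<ominus>\<^bsub>A\<^esub> T n) =
        (?L m a' \<ominus>\<^bsub>A\<^esub> T (l (T m) n')) \<oplus>\<^bsub>A\<^esub> (?R m' a \<ominus>\<^bsub>A\<^esub> T (r (T m') n))"
      using mem mem' linear_maps_minus[OF A A bilinear_maps_right[OF L]]
        linear_maps_minus[OF A A bilinear_maps_right[OF R]]
      by (simp only: L_T R_T linear_maps_closed[OF T])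
    \<comment> \<open>Collecting all terms under a single \<open>T\<close> gives the class of the
      \<epsilon>-part of the product, which is \<open>(T m, m)\<close> times \<open>(a', n')\<close>
      plus \<open>(a, n)\<close> times \<open>(T m', m')\<close>.\<close>
    also have "\<dots> = (\<mu> (T m) a' \<oplus>\<^bsub>A\<^esub> \<mu> a (T m')) \<ominus>\<^bsub>A\<^esub>
        T ((l (T m) n' \<oplus>\<^bsub>M\<^esub> r a' m) \<oplus>\<^bsub>M\<^esub> (l a m' \<oplus>\<^bsub>M\<^esub> r (T m') n))"
      using mem mem' by (simp add: a_minus_def A.minus_add A.a_ac T_simps closed)
    finally show "\<pi> (dual_product ?B ?\<beta> x y) = bimodule_product ?star A ?L ?R (\<pi> x) (\<pi> y)"
      by (simp add: x_eq y_eq \<pi>_def bimodule_product_eq)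
  qed
  then show ?thesis
    using star_cat A L R by (simp add: bimodule_def)
qed

end
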